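(* Let $\mathcal{X}=\{\mathbf{x}\in\mathbb{Z}^n:\ell_i\le x_i\le u_i\ \forall i\in N\}$, let $f:\mathcal{X}\to\mathbb{R}$ be L$^\natural$-convex, and let $\mathcal{P}^f_{\mathcal{X}}=\{(w,\mathbf{x})\in\mathbb{R}\times\mathcal{X}:w\ge f(\mathbf{x})\}$. Suppose $\mathcal{X}\supseteq\mathcal{B}_{\mathbf{q}}=\{\mathbf{x}\in\mathbb{Z}^n:q_i\le x_i\le q_i+1\ \forall i\in N\}$ for some $\mathbf{q}\in\mathbb{Z}^n$. Then $\mathcal{P}^f_{\mathcal{X}}$ is full-dimensional (it contains $n+2$ affinely independent points), and for every $\mathbf{p}\in\underline{\mathcal{X}}$ and every permutation $\boldsymbol\delta$ of $N$, the inequality $$w\ \ge\ f(\mathbf{p})+\sum_{i=1}^n\Big[f\Big(\mathbf{p}+\sum_{j=1}^{i}\mathbf{1}^{\delta(j)}\Big)-f\Big(\mathbf{p}+\sum_{j=1}^{i-1}\mathbf{1}^{\delta(j)}\Big)\Big](x_{\delta(i)}-p_{\delta(i)})$$ is facet-defining for $\mathcal{P}^f_{\mathcal{X}}$.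
   Context: $N=\{1,\dots,n\}$; $\ell_i\in\mathbb{Z}\cup\{-\infty\}$, $u_i\in\mathbb{Z}\cup\{+\infty\}$; $\underline{\mathcal{X}}=\{\mathbf{x}\in\mathbb{Z}^n:\ell_i\le x_i\le u_i-1\ \forall i\}$ (with $\infty-1=\infty$). $f$ is L$^\natural$-convex if $f(\mathbf{x})+f(\mathbf{y})\ge f(\lceil(\mathbf{x}+\mathbf{y})/2\rceil)+f(\lfloor(\mathbf{x}+\mathbf{y})/2\rfloor)$ for all $\mathbf{x},\mathbf{y}\in\mathcal{X}$ (component-wise rounding). $\mathbf{1}^i$ is the $i$-th unit vector. An inequality is facet-defining for a full-dimensional set $\mathcal{P}\subseteq\mathbb{R}^{n+1}$ if it holds at every point of $\mathcal{P}$ and holds with equality at $n+1$ affinely independent points of $\mathcal{P}$, but not at all points of $\mathcal{P}$. *)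

theory Defs
  imports "HOL-Analysis.Analysis" "HOL-Library.Extended"
begin

text \<open>
  The index set \<open>N = {1,\<dots>,n}\<close> is a finite type \<open>'n\<close> with \<open>n = CARD('n)\<close>, so that \<open>\<int>\<^sup>n\<close> is
  \<open>int ^ 'n\<close> and \<open>\<real>\<^sup>n\<^sup>+\<^sup>1\<close> is \<open>real \<times> (real ^ 'n)\<close>, the coordinate \<open>w\<close> coming first.
  Bounds live in \<open>int extended\<close>, where \<open>Pinf - 1 = Pinf\<close>.
\<close>

definition int_box :: "('n \<Rightarrow> int extended) \<Rightarrow> ('n \<Rightarrow> int extended) \<Rightarrow> (int ^ 'n) set" where
  "int_box l u = {x. \<forall>i. l i \<le> Fin (x $ i) \<and> Fin (x $ i) \<le> u i}"

definition int_box_lower :: "('n \<Rightarrow> int extended) \<Rightarrow> ('n \<Rightarrow> int extended) \<Rightarrow> (int ^ 'n) set" where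
  "int_box_lower l u = {x. \<forall>i. l i \<le> Fin (x $ i) \<and> Fin (x $ i) \<le> u i - 1}"

definition unit_box :: "int ^ 'n \<Rightarrow> (int ^ 'n) set" where
  "unit_box q = {x. \<forall>i. q $ i \<le> x $ i \<and> x $ i \<le> q $ i + 1}"

definition mid_ceil :: "int ^ 'n \<Rightarrow> int ^ 'n \<Rightarrow> int ^ 'n" where
  "mid_ceil x y = (\<chi> i. \<lceil>real_of_int (x $ i + y $ i) / 2\<rceil>)"

definition mid_floor :: "int ^ 'n \<Rightarrow> int ^ 'n \<Rightarrow> int ^ 'n" where
  "mid_floor x y = (\<chi> i. \<lfloor>real_of_int (x $ i + y $ i) / 2\<rfloor>)"

text \<open>
  Functions on \<open>X\<close> are total functions whose values outside \<open>X\<close> are irrelevant. When \<open>X\<close> is an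
  integer box, both rounded midpoints of two points of \<open>X\<close> lie in \<open>X\<close>.
\<close>

definition L_natural_convex_on :: "(int ^ 'n) set \<Rightarrow> (int ^ 'n \<Rightarrow> real) \<Rightarrow> bool" where
  "L_natural_convex_on X f \<longleftrightarrow>
     (\<forall>x\<in>X. \<forall>y\<in>X. f x + f y \<ge> f (mid_ceil x y) + f (mid_floor x y))"

definition real_vec :: "int ^ 'n \<Rightarrow> real ^ 'n" where
  "real_vec x = (\<chi> i. real_of_int (x $ i))"

definition mixed_epigraph :: "(int ^ 'n) set \<Rightarrow> (int ^ 'n \<Rightarrow> real) \<Rightarrow> (real \<times> (real ^ 'n)) set" where
  "mixed_epigraph X f = {(w, real_vec x) | w x. x \<in> X \<and> w \<ge> f x}"

definition full_dimensional :: "'a::euclidean_space set \<Rightarrow> bool" where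
  "full_dimensional P \<longleftrightarrow>
     (\<exists>S\<subseteq>P. finite S \<and> card S = DIM('a) + 1 \<and> \<not> affine_dependent S)"

text \<open>
  \<open>facet_defining P g h\<close> concerns the inequality \<open>g z \<ge> h z\<close>; it is meant for full-dimensional
  \<open>P\<close> and affine \<open>g\<close> and \<open>h\<close>.
\<close>

definition facet_defining :: "'a::euclidean_space set \<Rightarrow> ('a \<Rightarrow> real) \<Rightarrow> ('a \<Rightarrow> real) \<Rightarrow> bool" where
  "facet_defining P g h \<longleftrightarrow>
     (\<forall>z\<in>P. g z \<ge> h z) \<and>
     (\<exists>S\<subseteq>P. finite S \<and> card S = DIM('a) \<and> \<not> affine_dependent S \<and> (\<forall>z\<in>S. g z = h z)) \<and>
     (\<exists>z\<in>P. g z \<noteq> h z)"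

text \<open>
  A permutation of \<open>N\<close> is given by its values \<open>\<delta>(1),\<dots>,\<delta>(n)\<close>, that is, by a bijection \<open>\<delta>\<close> from
  \<open>{1..CARD('n)}\<close> onto the index type.
\<close>

definition chain_point :: "int ^ 'n \<Rightarrow> (nat \<Rightarrow> 'n) \<Rightarrow> nat \<Rightarrow> int ^ 'n" where
  "chain_point p \<delta> k = p + (\<Sum>j = 1..k. axis (\<delta> j) 1)"

definition chain_bound ::
    "(int ^ 'n \<Rightarrow> real) \<Rightarrow> int ^ 'n \<Rightarrow> (nat \<Rightarrow> 'n) \<Rightarrow> real ^ 'n \<Rightarrow> real" where
  "chain_bound f p \<delta> x =
     f p + (\<Sum>i = 1..CARD('n). (f (chain_point p \<delta> i) - f (chain_point p \<delta> (i - 1)))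
                                * (x $ \<delta> i - real_of_int (p $ \<delta> i)))"

end

theory Submission
  imports Defs
begin

text \<open>
  Subtracting the affine right-hand side from \<open>f\<close> gives an \<open>L\<^sup>\<natural>\<close>-convex function \<open>h\<close> that vanishes
  on the chain, and validity means \<open>h \<ge> 0\<close>. On the unit box at \<open>p\<close>, \<open>L\<^sup>\<natural>\<close>-convexity is
  submodularity, and meeting \<open>x\<close> with successive chain points gives \<open>h x \<ge> 0\<close>. Elsewhere, the
  rounded midpoints of \<open>x\<close> and \<open>p\<close> are closer to \<open>p\<close> than \<open>x\<close> as long as the \<open>\<ell>\<^sub>\<infinity>\<close>-distance of
  \<open>x\<close> to \<open>p\<close> is at least 2, and at distance at most 1 the rounded midpoints of \<open>x\<close> and \<open>p + 1\<close> lie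
  in the unit box. The lifted chain points provide the \<open>n + 1\<close> tight points, and a point above one
  of them completes these to \<open>n + 2\<close> affinely independent ones.
\<close>

section \<open>Rounded midpoints and integer boxes\<close>

lemma mid_floor_nth: "mid_floor x y $ i = (x $ i + y $ i) div 2"
  using floor_divide_of_int_eq[of "x $ i + y $ i" 2] by (simp add: mid_floor_def)

lemma mid_ceil_nth: "mid_ceil x y $ i = (x $ i + y $ i + 1) div 2"
proof -
  have "\<lceil>real_of_int (x $ i + y $ i) / 2\<rceil> = - (- (x $ i + y $ i) div 2)"
    using ceiling_divide_eq_div[of "x $ i + y $ i" 2] by simp
  then show ?thesis
    unfolding mid_ceil_def by simp
qed

lemma mid_ceil_plus_mid_floor: "mid_ceil x y $ i + mid_floor x y $ i = x $ i + y $ i"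
  unfolding mid_ceil_nth mid_floor_nth by presburger

lemma int_box_between:
  assumes "x \<in> int_box l u" "y \<in> int_box l u"
    and "\<And>i. min (x $ i) (y $ i) \<le> z $ i" "\<And>i. z $ i \<le> max (x $ i) (y $ i)"
  shows "z \<in> int_box l u"
  unfolding int_box_def
proof (intro CollectI allI conjI)
  fix i
  have "l i \<le> Fin (min (x $ i) (y $ i))" "Fin (max (x $ i) (y $ i)) \<le> u i"
    using assms(1,2) by (auto simp: int_box_def min_def max_def)
  moreover have "Fin (min (x $ i) (y $ i)) \<le> Fin (z $ i)" "Fin (z $ i) \<le> Fin (max (x $ i) (y $ i))"
    using assms(3,4) by auto
  ultimately show "l i \<le> Fin (z $ i)" "Fin (z $ i) \<le> u i"
    by (metis order_trans)+
qed

lemma mid_in_int_box: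
  assumes "x \<in> int_box l u" "y \<in> int_box l u"
  shows "mid_ceil x y \<in> int_box l u" "mid_floor x y \<in> int_box l u"
proof -
  have "min (x $ i) (y $ i) \<le> mid_ceil x y $ i" "mid_ceil x y $ i \<le> max (x $ i) (y $ i)"
    "min (x $ i) (y $ i) \<le> mid_floor x y $ i" "mid_floor x y $ i \<le> max (x $ i) (y $ i)" for i
    unfolding mid_ceil_nth mid_floor_nth by linarith+
  then show "mid_ceil x y \<in> int_box l u" "mid_floor x y \<in> int_box l u"
    using int_box_between[OF assms] by blast+
qed

lemma unit_box_subset_int_box:
  assumes "p \<in> int_box_lower l u" "\<And>i. u i \<noteq> Minf"
  shows "unit_box p \<subseteq> int_box l u"
proof
  fix x assume x: "x \<in> unit_box p"
  show "x \<in> int_box l u"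
    unfolding int_box_def
  proof (intro CollectI allI conjI)
    fix i
    have p: "l i \<le> Fin (p $ i)" "Fin (p $ i) \<le> u i - 1"
      and xi: "p $ i \<le> x $ i" "x $ i \<le> p $ i + 1"
      using assms(1) x by (auto simp: int_box_lower_def unit_box_def)
    show "l i \<le> Fin (x $ i)"
      using p(1) xi(1) by (cases "l i") auto
    show "Fin (x $ i) \<le> u i"
      using p(2) xi(2) assms(2)[of i] by (cases "u i") (auto simp: one_extended_def)
  qed
qed

section \<open>Chain points and the affine right-hand side\<close>

lemma chain_point_nth:
  assumes "inj_on \<delta> {1..n}" "k \<le> n"
  shows "chain_point p \<delta> k $ i = p $ i + (if i \<in> \<delta> ` {1..k} then 1 else 0)"
proof -
  have "inj_on \<delta> {1..k}"
    using assms by (auto intro: inj_on_subset)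
  \<comment> \<open>Injectivity makes the summed unit vectors distinct, so no coordinate is raised
    twice.\<close>
  then have "(\<Sum>j = 1..k. (axis (\<delta> j) 1 :: int ^ 'a) $ i) = (\<Sum>a \<in> \<delta> ` {1..k}. if i = a then 1 else 0)"
    by (subst sum.reindex) (auto simp: axis_def intro!: sum.cong)
  then show ?thesis
    by (simp add: chain_point_def)
qed

lemma chain_point_nth_delta:
  assumes "inj_on \<delta> {1..n}" "k \<le> n" "i \<in> {1..n}"
  shows "chain_point p \<delta> k $ \<delta> i = p $ \<delta> i + (if i \<le> k then 1 else 0)"
proof -
  have "\<delta> i \<in> \<delta> ` {1..k} \<longleftrightarrow> i \<in> {1..k}"
    by (rule inj_on_image_mem_iff[OF assms(1)]) (use assms in auto)
  then show ?thesis
    using chain_point_nth[OF assms(1,2), of p "\<delta> i"] assms(3) by auto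
qed

lemma chain_point_in_unit_box:
  assumes "inj_on \<delta> {1..n}" "k \<le> n"
  shows "chain_point p \<delta> k \<in> unit_box p"
  unfolding unit_box_def by (auto simp: chain_point_nth[OF assms])

text \<open>At the \<open>k\<close>-th chain point the factor of the \<open>i\<close>-th difference
  is 1 for \<open>i \<le> k\<close> and 0 otherwise, so the sum telescopes.\<close>

lemma chain_bound_chain_point:
  fixes p :: "int ^ 'n::finite"
  assumes "inj_on \<delta> {1..CARD('n)}" "k \<le> CARD('n)"
  shows "chain_bound f p \<delta> (real_vec (chain_point p \<delta> k)) = f (chain_point p \<delta> k)"
proof -
  let ?d = "\<lambda>i. f (chain_point p \<delta> i) - f (chain_point p \<delta> (i - 1))"
  have "(\<Sum>i = 1..CARD('n). ?d i * (real_vec (chain_point p \<delta> k) $ \<delta> i - real_of_int (p $ \<delta> i)))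
      = (\<Sum>i = 1..CARD('n). if i \<le> k then ?d i else 0)"
    by (intro sum.cong refl) (auto simp: real_vec_def chain_point_nth_delta[OF assms])
  also have "\<dots> = (\<Sum>i = 1..k. ?d i)"
    using assms(2) by (subst sum.inter_filter[symmetric]) (auto intro!: sum.cong)
  also have "\<dots> = f (chain_point p \<delta> k) - f (chain_point p \<delta> 0)"
    by (induction k) auto
  finally show ?thesis
    by (simp add: chain_bound_def chain_point_def)
qed

text \<open>The bound is affine in \<open>x\<close>, and rounding one midpoint up and the other down
  preserves the sum of the two points. Hence subtracting the bound keeps the midpoint inequality
  intact.\<close>

lemma chain_bound_midpoints:
  fixes x y :: "int ^ 'n"
  shows "chain_bound f p \<delta> (real_vec (mid_ceil x y)) + chain_bound f p \<delta> (real_vec (mid_floor x y))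
    = chain_bound f p \<delta> (real_vec x) + chain_bound f p \<delta> (real_vec y)"
proof -
  have *: "real_of_int (mid_ceil x y $ i) + real_of_int (mid_floor x y $ i)
      = real_of_int (x $ i) + real_of_int (y $ i)" for i
    by (metis mid_ceil_plus_mid_floor of_int_add)
  have "d * (real_of_int (mid_ceil x y $ i) - r) + d * (real_of_int (mid_floor x y $ i) - r)
      = d * (real_of_int (x $ i) - r) + d * (real_of_int (y $ i) - r)" for d r i
    using arg_cong[OF *[of i], of "\<lambda>t. d * (t - 2 * r)"] by (simp add: algebra_simps)
  then have "(\<Sum>k\<in>K. d k * (real_of_int (mid_ceil x y $ \<delta> k) - r k))
      + (\<Sum>k\<in>K. d k * (real_of_int (mid_floor x y $ \<delta> k) - r k))
      = (\<Sum>k\<in>K. d k * (real_of_int (x $ \<delta> k) - r k))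
      + (\<Sum>k\<in>K. d k * (real_of_int (y $ \<delta> k) - r k))" for K d r
    unfolding sum.distrib[symmetric] by (rule sum.cong[OF refl])
  from this[where K = "{1..CARD('n)}"] show ?thesis
    by (simp add: chain_bound_def real_vec_def)
qed

section \<open>Validity of the inequality\<close>

lemma L_natural_convex_on_diff_chain_bound:
  assumes "L_natural_convex_on X f"
  shows "L_natural_convex_on X (\<lambda>x. f x - chain_bound g p \<delta> (real_vec x))"
  unfolding L_natural_convex_on_def
proof (intro ballI)
  fix x y assume "x \<in> X" "y \<in> X"
  then have "f (mid_ceil x y) + f (mid_floor x y) \<le> f x + f y"
    using assms by (auto simp: L_natural_convex_on_def)
  then show "f (mid_ceil x y) - chain_bound g p \<delta> (real_vec (mid_ceil x y))
      + (f (mid_floor x y) - chain_bound g p \<delta> (real_vec (mid_floor x y)))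
      \<le> f x - chain_bound g p \<delta> (real_vec x) + (f y - chain_bound g p \<delta> (real_vec y))"
    using chain_bound_midpoints[of g p \<delta> x y] by linarith
qed

text \<open>The meets \<open>m k\<close> of \<open>x\<close> with the chain points lead from
  \<open>p\<close> to \<open>x\<close>, and \<open>h\<close> never decreases along them: each step
  that changes the meet is one midpoint inequality in which both chain values vanish.\<close>

lemma nonneg_on_unit_box:
  fixes h :: "int ^ 'n::finite \<Rightarrow> real"
  assumes conv: "L_natural_convex_on X h" and sub: "unit_box p \<subseteq> X"
    and bij: "bij_betw \<delta> {1..CARD('n)} (UNIV :: 'n set)"
    and zero: "\<And>k. k \<le> CARD('n) \<Longrightarrow> h (chain_point p \<delta> k) = 0"
    and x: "x \<in> unit_box p"
  shows "h x \<ge> 0"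
proof -
  have inj: "inj_on \<delta> {1..CARD('n)}" and im: "\<delta> ` {1..CARD('n)} = UNIV"
    using bij by (auto simp: bij_betw_def)
  have eqI: "a = b" if "\<And>i. i \<in> {1..CARD('n)} \<Longrightarrow> a $ \<delta> i = b $ \<delta> i" for a b :: "int ^ 'n"
    unfolding vec_eq_iff using that im by (metis UNIV_I imageE)
  note nth = chain_point_nth_delta[OF inj]
  define m where "m k = (\<chi> i. min (x $ i) (chain_point p \<delta> k $ i))" for k
  have xi: "x $ i = p $ i \<or> x $ i = p $ i + 1" for i
    using x by (auto simp: unit_box_def) (metis order_antisym_conv zless_imp_add1_zle linorder_not_le)
  have m_box: "m k \<in> unit_box p" if "k \<le> CARD('n)" for k
    using x chain_point_in_unit_box[OF inj that, of p]
    by (fastforce simp: m_def unit_box_def min_def)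
  have "h (m k) \<ge> 0" if "k \<le> CARD('n)" for k
    using that
  proof (induction k)
    case 0
    have "m 0 = chain_point p \<delta> 0"
      using x by (auto simp: m_def vec_eq_iff chain_point_def unit_box_def)
    then show ?case
      using zero by simp
  next
    case (Suc k)
    show ?case
    proof (cases "x $ \<delta> (Suc k) = p $ \<delta> (Suc k)")
      case True
      \<comment> \<open>The only coordinate raised by the next chain point is one where
        \<open>x\<close> agrees with \<open>p\<close>.\<close>
      have "m (Suc k) = m k"
        by (rule eqI) (use True x Suc.prems in \<open>auto simp: m_def nth unit_box_def le_Suc_eq\<close>)
      then show ?thesis
        using Suc by simp
    next
      case False
      let ?c = "chain_point p \<delta> k"
      \<comment> \<open>Within a unit box, rounding the midpoint up gives the join and rounding it
        down gives the meet.\<close>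
      have "mid_ceil (m (Suc k)) ?c = chain_point p \<delta> (Suc k)"
      proof (rule eqI)
        fix i assume "i \<in> {1..CARD('n)}"
        then show "mid_ceil (m (Suc k)) ?c $ \<delta> i = chain_point p \<delta> (Suc k) $ \<delta> i"
          using False xi[of "\<delta> i"] Suc.prems by (auto simp: mid_ceil_nth m_def nth le_Suc_eq)
      qed
      moreover have "mid_floor (m (Suc k)) ?c = m k"
      proof (rule eqI)
        fix i assume "i \<in> {1..CARD('n)}"
        then show "mid_floor (m (Suc k)) ?c $ \<delta> i = m k $ \<delta> i"
          using False xi[of "\<delta> i"] Suc.prems by (auto simp: mid_floor_nth m_def nth le_Suc_eq)
      qed
      moreover have "m (Suc k) \<in> X" "?c \<in> X"
        using m_box[OF Suc.prems] chain_point_in_unit_box[OF inj, of k p] Suc.prems sub by auto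
      ultimately have "h (m (Suc k)) + h ?c \<ge> h (chain_point p \<delta> (Suc k)) + h (m k)"
        using conv unfolding L_natural_convex_on_def by metis
      then show ?thesis
        using Suc zero[of k] zero[of "Suc k"] by simp
    qed
  qed
  moreover have "m (CARD('n)) = x"
    by (rule eqI) (use x in \<open>auto simp: m_def nth unit_box_def\<close>)
  ultimately show ?thesis
    by (metis order_refl)
qed

lemma nonneg_on_int_box:
  fixes h :: "int ^ 'n::finite \<Rightarrow> real"
  assumes conv: "L_natural_convex_on (int_box l u) h"
    and sub: "unit_box p \<subseteq> int_box l u"
    and nonneg: "\<And>x. x \<in> unit_box p \<Longrightarrow> h x \<ge> 0"
    and zero: "h p = 0" "h (p + 1) = 0"
    and x: "x \<in> int_box l u"
  shows "h x \<ge> 0"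
proof -
  have corners: "p \<in> int_box l u" "p + 1 \<in> int_box l u"
    using sub by (auto simp: unit_box_def)
  \<comment> \<open>Pairing \<open>x\<close> with a zero of \<open>h\<close> turns the midpoint
    inequality into a lower bound for \<open>h x\<close> alone.\<close>
  have step: "h x \<ge> 0"
    if "x \<in> int_box l u" "y \<in> int_box l u" "h y = 0"
      "h (mid_ceil x y) \<ge> 0" "h (mid_floor x y) \<ge> 0" for x y
    using conv that unfolding L_natural_convex_on_def by (metis add.right_neutral add_nonneg_nonneg order_trans)
  \<comment> \<open>The summand 1 makes distance at most 1 the base case: there, midpoints with
    \<open>p\<close> may make no progress, since an offset of -1 rounds down to -1 again.\<close>
  have claim: "h x \<ge> 0" if "x \<in> int_box l u" "\<And>i. \<bar>x $ i - p $ i\<bar> \<le> int m + 1" for x m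
    using that
  proof (induction m arbitrary: x)
    case 0
    \<comment> \<open>Relative to \<open>p\<close>, the coordinate sums with \<open>p + 1\<close>
      are 0, 1 or 2, so their halves round to 0 or 1.\<close>
    have "mid_ceil x (p + 1) \<in> unit_box p" "mid_floor x (p + 1) \<in> unit_box p"
    proof -
      have "p $ i \<le> mid_ceil x (p + 1) $ i \<and> mid_ceil x (p + 1) $ i \<le> p $ i + 1 \<and>
         p $ i \<le> mid_floor x (p + 1) $ i \<and> mid_floor x (p + 1) $ i \<le> p $ i + 1" for i
        using "0.prems"(2)[of i] by (simp add: mid_ceil_nth mid_floor_nth) linarith
      then show "mid_ceil x (p + 1) \<in> unit_box p" "mid_floor x (p + 1) \<in> unit_box p"
        by (simp_all add: unit_box_def)
    qed
    then show ?case
      using step[OF "0.prems"(1) corners(2) zero(2)] nonneg by blast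
  next
    case (Suc m)
    \<comment> \<open>An offset of absolute value at most \<open>m + 2\<close>, halved and rounded
      either way, is at most \<open>m + 1\<close> in absolute value.\<close>
    have "\<bar>mid_ceil x p $ i - p $ i\<bar> \<le> int m + 1 \<and> \<bar>mid_floor x p $ i - p $ i\<bar> \<le> int m + 1" for i
      using Suc.prems(2)[of i] by (simp add: mid_ceil_nth mid_floor_nth) linarith
    then show ?case
      using step[OF Suc.prems(1) corners(1) zero(1)] Suc.IH mid_in_int_box[OF Suc.prems(1) corners(1)]
      by blast
  qed
  \<comment> \<open>The sum of the absolute offsets is a convenient bound on all of them at
    once.\<close>
  define m where "m = nat (\<Sum>i\<in>UNIV. \<bar>x $ i - p $ i\<bar>)"
  have "\<bar>x $ i - p $ i\<bar> \<le> int m + 1" for i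
    using member_le_sum[of i UNIV "\<lambda>i. \<bar>x $ i - p $ i\<bar>"] by (simp add: m_def)
  then show ?thesis
    using claim x by blast
qed

lemma chain_bound_le:
  fixes f :: "int ^ 'n::finite \<Rightarrow> real"
  assumes "L_natural_convex_on (int_box l u) f" "unit_box p \<subseteq> int_box l u"
    and bij: "bij_betw \<delta> {1..CARD('n)} (UNIV :: 'n set)"
    and "x \<in> int_box l u"
  shows "chain_bound f p \<delta> (real_vec x) \<le> f x"
proof -
  define h where "h x = f x - chain_bound f p \<delta> (real_vec x)" for x
  have inj: "inj_on \<delta> {1..CARD('n)}" and im: "\<delta> ` {1..CARD('n)} = UNIV"
    using bij by (auto simp: bij_betw_def)
  have conv: "L_natural_convex_on (int_box l u) h"
    unfolding h_def by (rule L_natural_convex_on_diff_chain_bound[OF assms(1)])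
  have zero: "h (chain_point p \<delta> k) = 0" if "k \<le> CARD('n)" for k
    using chain_bound_chain_point[OF inj that, of f p] by (simp add: h_def)
  \<comment> \<open>The ends of the chain are the two zeros of \<open>h\<close> against which
    midpoints are taken; the upper one is \<open>p + 1\<close> because \<delta> is onto.\<close>
  have "chain_point p \<delta> 0 = p" "chain_point p \<delta> (CARD('n)) = p + 1"
    using im by (auto simp: vec_eq_iff chain_point_nth[OF inj])
  then have "h p = 0" "h (p + 1) = 0"
    using zero[of 0] zero[of "CARD('n)"] by auto
  then have "h x \<ge> 0"
    using nonneg_on_int_box[OF conv assms(2)] nonneg_on_unit_box[OF conv assms(2) bij zero] assms(4)
    by blast
  then show ?thesis
    by (simp add: h_def)
qed

section \<open>Affine independence of lifted chains\<close>

lemma affine_independent_Un_image: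
  fixes z :: "nat \<Rightarrow> 'a::euclidean_space"
  assumes "finite B" "\<not> affine_dependent B"
    and "\<And>k. k \<in> {1..m} \<Longrightarrow> \<exists>H. affine H \<and> B \<union> z ` {1..<k} \<subseteq> H \<and> z k \<notin> H"
  shows "\<not> affine_dependent (B \<union> z ` {1..m}) \<and> card (B \<union> z ` {1..m}) = card B + m"
  using assms(3)
proof (induction m)
  case 0
  then show ?case
    using assms(2) by simp
next
  case (Suc m)
  let ?S = "B \<union> z ` {1..m}"
  have IH: "\<not> affine_dependent ?S" "card ?S = card B + m"
    using Suc by auto
  have "{1..<Suc m} = {1..m}"
    by auto
  with Suc.prems[of "Suc m"] obtain H where "affine H" "?S \<subseteq> H" "z (Suc m) \<notin> H"
    by auto
  \<comment> \<open>An affine set containing all earlier points contains their hull, so missing that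
    set is enough to extend the independent family.\<close>
  then have "z (Suc m) \<notin> affine hull ?S"
    using hull_minimal[of ?S H affine] by blast
  moreover from this have "z (Suc m) \<notin> ?S"
    using hull_subset[of ?S affine] by blast
  moreover have "B \<union> z ` {1..Suc m} = insert (z (Suc m)) ?S"
    by (auto simp: atLeastAtMostSuc_conv)
  ultimately show ?case
    using affine_independent_insert[of ?S "z (Suc m)"] IH assms(1) by simp
qed

text \<open>The \<open>k\<close>-th chain point is the first to leave the hyperplane on which
  coordinate \<open>\<delta> k\<close> keeps its value at \<open>p\<close>. The normal has no
  \<open>w\<close>-component, so the heights \<open>g\<close> are arbitrary. The base
  \<open>B\<close> over \<open>p\<close> is left open so that one or two points can be placed
  there.\<close>

lemma affine_independent_chain_lift:
  fixes p :: "int ^ 'n::finite" and B :: "(real \<times> (real ^ 'n)) set"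
  assumes inj: "inj_on \<delta> {1..CARD('n)}"
    and B: "finite B" "\<not> affine_dependent B" "B \<subseteq> UNIV \<times> {real_vec p}"
    and S: "S = B \<union> (\<lambda>k. (g k, real_vec (chain_point p \<delta> k))) ` {1..CARD('n)}"
  shows "\<not> affine_dependent S \<and> card S = card B + CARD('n)"
  unfolding S
proof (rule affine_independent_Un_image[OF B(1,2)])
  fix k assume k: "k \<in> {1..CARD('n)}"
  let ?z = "\<lambda>k. (g k, real_vec (chain_point p \<delta> k))"
  let ?H = "{z :: real \<times> (real ^ 'n). (0, axis (\<delta> k) 1) \<bullet> z = real_of_int (p $ \<delta> k)}"
  have inner: "(0, axis (\<delta> k) 1) \<bullet> z = snd z $ \<delta> k" for z :: "real \<times> (real ^ 'n)"
    by (simp add: inner_prod_def inner_axis')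
  have "affine ?H"
    by (rule affine_hyperplane)
  moreover have "B \<union> ?z ` {1..<k} \<subseteq> ?H"
    using B(3) k by (auto simp: inner real_vec_def chain_point_nth_delta[OF inj])
  moreover have "?z k \<notin> ?H"
    using k by (simp add: inner real_vec_def chain_point_nth_delta[OF inj])
  ultimately show "\<exists>H. affine H \<and> B \<union> ?z ` {1..<k} \<subseteq> H \<and> ?z k \<notin> H"
    by blast
qed

section \<open>Full-dimensionality and the facet property\<close>

lemma full_dimensional_mixed_epigraph:
  fixes f :: "int ^ 'n::finite \<Rightarrow> real"
  assumes "unit_box q \<subseteq> X"
  shows "full_dimensional (mixed_epigraph X f)"
proof -
  obtain \<delta> where "bij_betw \<delta> {1..CARD('n)} (UNIV :: 'n set)"
    using ex_bij_betw_nat_finite_1[of "UNIV :: 'n set"] by auto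
  then have inj: "inj_on \<delta> {1..CARD('n)}"
    by (rule bij_betw_imp_inj_on)
  \<comment> \<open>Two heights over \<open>q\<close> supply the vertical direction; with the
    \<open>n\<close> later chain points this makes \<open>n + 2\<close> points.\<close>
  let ?B = "{(f q, real_vec q), (f q + 1, real_vec q)}"
  define S where "S = ?B \<union> (\<lambda>k. (f (chain_point q \<delta> k), real_vec (chain_point q \<delta> k))) ` {1..CARD('n)}"
  have "\<not> affine_dependent S \<and> card S = card ?B + CARD('n)"
    by (rule affine_independent_chain_lift[OF inj _ _ _ S_def]) (auto simp: affine_independent_2)
  moreover have "q \<in> X" "\<And>k. k \<in> {1..CARD('n)} \<Longrightarrow> chain_point q \<delta> k \<in> X"
    using assms chain_point_in_unit_box[OF inj] by (auto simp: unit_box_def)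
  then have "S \<subseteq> mixed_epigraph X f"
    by (fastforce simp: S_def mixed_epigraph_def)
  moreover have "finite S"
    by (simp add: S_def)
  ultimately show ?thesis
    unfolding full_dimensional_def by (intro exI[of _ S]) simp
qed

lemma facet_defining_chain_bound:
  fixes f :: "int ^ 'n::finite \<Rightarrow> real"
  assumes conv: "L_natural_convex_on (int_box l u) f" and sub: "unit_box p \<subseteq> int_box l u"
    and bij: "bij_betw \<delta> {1..CARD('n)} (UNIV :: 'n set)"
  shows "facet_defining (mixed_epigraph (int_box l u) f)
    (\<lambda>(w, x). w) (\<lambda>(w, x). chain_bound f p \<delta> x)"
  unfolding facet_defining_def
proof (intro conjI)
  have inj: "inj_on \<delta> {1..CARD('n)}"
    using bij by (rule bij_betw_imp_inj_on)
  have p: "p \<in> int_box l u" and c: "\<And>k. k \<in> {1..CARD('n)} \<Longrightarrow> chain_point p \<delta> k \<in> int_box l u"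
    using sub chain_point_in_unit_box[OF inj] by (auto simp: unit_box_def)
  have "chain_point p \<delta> 0 = p"
    by (simp add: chain_point_def)
  then have tight0: "chain_bound f p \<delta> (real_vec p) = f p"
    using chain_bound_chain_point[OF inj, of 0 f p] by simp
  show "\<forall>z\<in>mixed_epigraph (int_box l u) f.
      (case z of (w, x) \<Rightarrow> chain_bound f p \<delta> x) \<le> (case z of (w, x) \<Rightarrow> w)"
    using chain_bound_le[OF conv sub bij] by (fastforce simp: mixed_epigraph_def)
  \<comment> \<open>Raising \<open>w\<close> above the tight point over \<open>p\<close> makes the
    inequality strict.\<close>
  have "(f p + 1, real_vec p) \<in> mixed_epigraph (int_box l u) f"
    using p by (auto simp: mixed_epigraph_def)
  then show "\<exists>z\<in>mixed_epigraph (int_box l u) f.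
      (case z of (w, x) \<Rightarrow> w) \<noteq> (case z of (w, x) \<Rightarrow> chain_bound f p \<delta> x)"
    using tight0 by force
  \<comment> \<open>A single base point, as all points must be tight: with the \<open>n\<close>
    later chain points this gives \<open>n + 1\<close>, the dimension of the ambient space.\<close>
  let ?B = "{(f p, real_vec p)}"
  define S where "S = ?B \<union> (\<lambda>k. (f (chain_point p \<delta> k), real_vec (chain_point p \<delta> k))) ` {1..CARD('n)}"
  have "\<not> affine_dependent S \<and> card S = card ?B + CARD('n)"
    by (rule affine_independent_chain_lift[OF inj _ _ _ S_def]) auto
  moreover have "S \<subseteq> mixed_epigraph (int_box l u) f"
    using p c by (fastforce simp: S_def mixed_epigraph_def)
  moreover have "finite S"
    by (simp add: S_def)
  moreover have "\<forall>z\<in>S. (case z of (w, x) \<Rightarrow> w) = (case z of (w, x) \<Rightarrow> chain_bound f p \<delta> x)"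
    using tight0 chain_bound_chain_point[OF inj, of _ f p] by (auto simp: S_def)
  ultimately show "\<exists>S\<subseteq>mixed_epigraph (int_box l u) f. finite S \<and> card S = DIM(real \<times> (real ^ 'n)) \<and>
      \<not> affine_dependent S \<and>
      (\<forall>z\<in>S. (case z of (w, x) \<Rightarrow> w) = (case z of (w, x) \<Rightarrow> chain_bound f p \<delta> x))"
    by (intro exI[of _ S]) simp
qed

theorem proposition3p4:
  fixes l u :: "'n::finite \<Rightarrow> int extended"
    and f :: "int ^ 'n \<Rightarrow> real"
    and q :: "int ^ 'n"
  assumes "\<And>i. l i \<noteq> Pinf"
    and "\<And>i. u i \<noteq> Minf"
    and "L_natural_convex_on (int_box l u) f"
    and "unit_box q \<subseteq> int_box l u"
  shows "full_dimensional (mixed_epigraph (int_box l u) f) \<and>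
    (\<forall>p \<in> int_box_lower l u. \<forall>\<delta>. bij_betw \<delta> {1..CARD('n)} (UNIV :: 'n set) \<longrightarrow>
       facet_defining (mixed_epigraph (int_box l u) f)
         (\<lambda>(w, x). w) (\<lambda>(w, x). chain_bound f p \<delta> x))"
  using full_dimensional_mixed_epigraph[OF assms(4)] facet_defining_chain_bound[OF assms(3)]
    unit_box_subset_int_box assms(2) by blast

end
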